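(* Let $a_n$ be the number of fillings of $\mathcal{P}_n$, i.e. the number of paths in $\mathcal{P}_n$ of the form $\widetilde{P}$ with $P\in\mathcal{P}_n$. Then $$ a_n = a_{n-1} + a_{n-2} + a_{n-3}, \quad n \ge 3, $$ with $a_0 = a_1 = 1$ and $a_2 = 3$; that is, $a_n = T_{n+1}$, where $(T_m)_{m\ge 0}$ is the tribonacci sequence (OEIS A000213) $T_0=T_1=T_2=1$, $T_m=T_{m-1}+T_{m-2}+T_{m-3}$ for $m\ge 3$.
   Context: A (binary) path of length $n$ is a lattice path $P=p_1\cdots p_n$ starting at the origin, each step being an upstep $u=(1,1)$ or a downstep $d=(1,-1)$; $\mathcal{P}_n$ is the set of paths of length $n$ ($\mathcal P_0$ consists of the empty path only). A valley of $P$ is the last point of a maximal run of $d$'s: it is either the middle point of an occurrence of $du$, or the endpoint of $P$ when $P$ ends with $d$. Turning a valley into a peak means replacing the corresponding $du$ by $ud$ (or, for a valley at the end of the path, the final $d$ by $u$). The filling of $P$ is the path $\widetilde P$ obtained by (simultaneously) turning every valley of $P$ into a peak; in particular $\widetilde{u^n}=u^n$. *)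

theory Defs
  imports Main
begin

datatype step = U | D

text \<open>
  A lattice path from the origin is given by its word of steps, \<open>U\<close> being \<open>(1,1)\<close> and
  \<open>D\<close> being \<open>(1,-1)\<close>. The points of a path of length \<open>n\<close> are numbered \<open>0, \<dots>, n\<close>
  (point \<open>j\<close> is reached after \<open>j\<close> steps), so that step \<open>P ! i\<close> leads from point \<open>i\<close>
  to point \<open>Suc i\<close>.
\<close>
type_synonym path = "step list"

definition paths :: "nat \<Rightarrow> path set" where
  "paths n = {P. length P = n}"

definition valleys :: "path \<Rightarrow> nat set" where
  "valleys P = {j. 0 < j \<and> j \<le> length P \<and> P ! (j - 1) = D \<and> (j < length P \<longrightarrow> P ! j = U)}"

text \<open>
  For a set \<open>V\<close> of valleys of \<open>P\<close>, all of them are turned at once: the step into each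
  point of \<open>V\<close> becomes \<open>U\<close> and the step out of it (absent if the point is the endpoint
  of \<open>P\<close>) becomes \<open>D\<close>. Two consecutive points are never both valleys, so the first two
  cases do not compete.
\<close>
definition turn_valleys :: "nat set \<Rightarrow> path \<Rightarrow> path" where
  "turn_valleys V P =
     map (\<lambda>i. if Suc i \<in> V then U else if i \<in> V then D else P ! i) [0..<length P]"

definition filling :: "path \<Rightarrow> path" where
  "filling P = turn_valleys (valleys P) P"

definition num_fillings :: "nat \<Rightarrow> nat" where
  "num_fillings n = card {Q \<in> paths n. \<exists>P \<in> paths n. Q = filling P}"

fun tribonacci :: "nat \<Rightarrow> nat" where
  "tribonacci 0 = 1"
| "tribonacci (Suc 0) = 1"
| "tribonacci (Suc (Suc 0)) = 1"
| "tribonacci (Suc (Suc (Suc m))) =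
     tribonacci (Suc (Suc m)) + tribonacci (Suc m) + tribonacci m"

end

theory Submission imports Defs begin

text \<open>
  Let \<open>A\<close> be the set of fillings, \<open>C\<close> the set of fillings of paths starting with \<open>D\<close>, and
  \<open>B = A \<union> D A\<close>. Reading fillings from the left, a filling starting with \<open>U\<close> is \<open>U\<close>
  followed by an element of \<open>B\<close>, one starting with \<open>D\<close> is \<open>D\<close> followed by an element of \<open>C\<close>.
  As \<open>C \<subseteq> A\<close>, this yields disjoint decompositions of \<open>A\<close>, \<open>B\<close> and \<open>C\<close>, hence
  \<open>a(n+1) = b(n) + c(n)\<close>, \<open>b(n+1) = b(n) + a(n)\<close> and \<open>c(n+2) = c(n+1) + a(n)\<close>,
  from which \<open>b\<close> and \<open>c\<close> are eliminated.
\<close>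

lemma zero_notin_valleys [simp]: "0 \<notin> valleys P"
  by (simp add: valleys_def)

text \<open>Prepending a step shifts every valley by one and can create a new one only at point 1,
  which is the endpoint if \<open>P\<close> is empty. All recursions for \<open>filling\<close> rest
  on this.\<close>

lemma Suc_in_valleys_Cons:
  "Suc j \<in> valleys (x # P) \<longleftrightarrow>
     (if j = 0 then x = D \<and> (P \<noteq> [] \<longrightarrow> hd P = U) else j \<in> valleys P)"
  by (cases j) (auto simp: valleys_def hd_conv_nth)

lemma filling_Nil [simp]: "filling [] = []"
  by (simp add: filling_def turn_valleys_def)

lemma length_filling [simp]: "length (filling P) = length P"
  by (simp add: filling_def turn_valleys_def)

lemma nth_filling:
  "i < length P \<Longrightarrow>
   filling P ! i = (if Suc i \<in> valleys P then U else if i \<in> valleys P then D else P ! i)"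
  by (simp add: filling_def turn_valleys_def)

lemma filling_U [simp]: "filling (U # P) = U # filling P"
proof (rule nth_equalityI)
  fix i assume "i < length (filling (U # P))"
  then show "filling (U # P) ! i = (U # filling P) ! i"
    by (cases i) (auto simp: nth_filling Suc_in_valleys_Cons)
qed simp

lemma filling_D [simp]: "filling [D] = [U]"
  by (rule nth_equalityI) (auto simp: nth_filling Suc_in_valleys_Cons)

text \<open>Turning the valley at point 1 uses up both steps. Point 2 is reached by
  \<open>U\<close>, so it is no valley and \<open>P\<close> is filled independently.\<close>

lemma filling_DU [simp]: "filling (D # U # P) = U # D # filling P"
proof (rule nth_equalityI)
  fix i assume "i < length (filling (D # U # P))"
  then show "filling (D # U # P) ! i = (U # D # filling P) ! i"
    by (cases i; cases "i - 1") (auto simp: nth_filling Suc_in_valleys_Cons)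
qed simp

lemma filling_DD [simp]: "filling (D # D # P) = D # filling (D # P)"
proof (rule nth_equalityI)
  fix i assume "i < length (filling (D # D # P))"
  then show "filling (D # D # P) ! i = (D # filling (D # P)) ! i"
    by (cases i) (auto simp: nth_filling Suc_in_valleys_Cons)
qed simp

definition fillings :: "nat \<Rightarrow> path set" where
  "fillings n = filling ` paths n"

definition D_fillings :: "nat \<Rightarrow> path set" where
  "D_fillings n = filling ` {P \<in> paths n. P \<noteq> [] \<and> hd P = D}"

text \<open>The set \<open>B\<close> of the overview, in the form in which it arises when an initial
  \<open>U\<close> is removed.\<close>

definition U_tails :: "nat \<Rightarrow> path set" where
  "U_tails n = {Q. U # Q \<in> fillings (Suc n)}"

lemma paths_0: "paths 0 = {[]}"
  by (auto simp: paths_def)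

lemma paths_Suc: "paths (Suc n) = Cons U ` paths n \<union> Cons D ` paths n"
proof -
  have "P \<in> Cons U ` paths n \<union> Cons D ` paths n" if P: "P \<in> paths (Suc n)" for P
  proof -
    obtain x Q where "P = x # Q" "length Q = n"
      using P by (cases P) (auto simp: paths_def)
    then show ?thesis by (cases x) (auto simp: paths_def)
  qed
  then show ?thesis by (auto simp: paths_def)
qed

lemma finite_paths: "finite (paths n)"
  by (induction n) (auto simp: paths_0 paths_Suc)

lemma finite_fillings: "finite (fillings n)"
  by (simp add: fillings_def finite_paths)

lemma finite_D_fillings: "finite (D_fillings n)"
  by (simp add: D_fillings_def finite_paths)

lemma finite_U_tails: "finite (U_tails n)"
  using finite_vimageI[OF finite_fillings, of "Cons U"] by (simp add: U_tails_def vimage_def)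

lemma num_fillings_eq: "num_fillings n = card (fillings n)"
proof -
  have "{Q \<in> paths n. \<exists>P \<in> paths n. Q = filling P} = fillings n"
    by (auto simp: fillings_def paths_def)
  then show ?thesis by (simp add: num_fillings_def)
qed

lemma D_fillings_subset: "D_fillings n \<subseteq> fillings n"
  by (auto simp: D_fillings_def fillings_def)

lemma D_fillings_Suc: "D_fillings (Suc n) = (\<lambda>P. filling (D # P)) ` paths n"
proof -
  have "{P \<in> paths (Suc n). P \<noteq> [] \<and> hd P = D} = Cons D ` paths n"
    by (auto simp: paths_Suc)
  then show ?thesis by (simp add: D_fillings_def image_image)
qed

lemma D_fillings_0: "D_fillings 0 = {}"
  by (simp add: D_fillings_def paths_0)

lemma D_fillings_1: "D_fillings (Suc 0) = {[U]}"
  by (simp add: D_fillings_Suc paths_0)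

lemma D_fillings_Suc_Suc:
  "D_fillings (Suc (Suc n)) =
     Cons U ` (Cons D ` fillings n) \<union> Cons D ` D_fillings (Suc n)"
  by (simp add: D_fillings_Suc fillings_def paths_Suc image_Un image_image)

lemma fillings_0: "fillings 0 = {[]}"
  by (simp add: fillings_def paths_0)

lemma fillings_Suc_union: "fillings (Suc n) = Cons U ` fillings n \<union> D_fillings (Suc n)"
  by (simp add: D_fillings_Suc fillings_def paths_Suc image_Un image_image)

text \<open>Only a path starting with two downsteps keeps \<open>D\<close> as its first step: an
  initial \<open>U\<close> stays, and \<open>D\<close> alone or before \<open>U\<close> is
  turned.\<close>

lemma D_tails: "D # Q \<in> fillings (Suc n) \<longleftrightarrow> Q \<in> D_fillings n"
  by (cases n) (auto simp: fillings_Suc_union D_fillings_0 D_fillings_1 D_fillings_Suc_Suc)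

lemma fillings_Suc: "fillings (Suc n) = Cons U ` U_tails n \<union> Cons D ` D_fillings n"
proof (rule set_eqI)
  fix P
  show "P \<in> fillings (Suc n) \<longleftrightarrow> P \<in> Cons U ` U_tails n \<union> Cons D ` D_fillings n"
  proof (cases P)
    case Nil
    then show ?thesis by (auto simp: fillings_def paths_def dest: arg_cong[of _ _ length])
  next
    case (Cons x Q)
    then show ?thesis by (cases x) (auto simp: U_tails_def D_tails)
  qed
qed

lemma U_tails_0: "U_tails 0 = {[]}"
  by (auto simp: U_tails_def fillings_Suc_union D_fillings_1 fillings_0)

lemma U_tails_Suc: "U_tails (Suc n) = Cons U ` U_tails n \<union> Cons D ` fillings n"
proof -
  have "U_tails (Suc n) = fillings (Suc n) \<union> Cons D ` fillings n"
    by (auto simp: U_tails_def fillings_Suc_union[of "Suc n"] D_fillings_Suc_Suc)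
  \<comment> \<open>The union above need not be disjoint, so it is regrouped by first step; the
    tails after \<open>D\<close> in \<open>fillings (Suc n)\<close> already lie in
    \<open>fillings n\<close>.\<close>
  also have "\<dots> = Cons U ` U_tails n \<union> Cons D ` fillings n"
    using D_fillings_subset by (auto simp: fillings_Suc)
  finally show ?thesis .
qed

lemma card_Cons_image [simp]: "card (Cons x ` S) = card S"
  by (simp add: card_image)

lemma card_Cons_union:
  assumes "finite S" "finite T" "x \<noteq> y"
  shows "card (Cons x ` S \<union> Cons y ` T) = card S + card T"
  using assms by (subst card_Un_disjoint) auto

lemma card_fillings_Suc: "card (fillings (Suc n)) = card (U_tails n) + card (D_fillings n)"
  by (simp add: fillings_Suc card_Cons_union finite_U_tails finite_D_fillings)

lemma card_U_tails_Suc: "card (U_tails (Suc n)) = card (U_tails n) + card (fillings n)"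
  by (simp add: U_tails_Suc card_Cons_union finite_U_tails finite_fillings)

lemma card_D_fillings_Suc_Suc:
  "card (D_fillings (Suc (Suc n))) = card (fillings n) + card (D_fillings (Suc n))"
  by (simp add: D_fillings_Suc_Suc card_Cons_union finite_fillings finite_D_fillings)

lemma num_fillings_0: "num_fillings 0 = 1"
  by (simp add: num_fillings_eq fillings_0)

lemma num_fillings_1: "num_fillings (Suc 0) = 1"
  by (simp add: num_fillings_eq card_fillings_Suc U_tails_0 D_fillings_0)

lemma num_fillings_2: "num_fillings (Suc (Suc 0)) = 3"
  by (simp add: num_fillings_eq card_fillings_Suc card_U_tails_Suc U_tails_0 D_fillings_1
      fillings_0)

text \<open>With \<open>a\<close>, \<open>b\<close>, \<open>c\<close> as in the overview, a(n+3) =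
  b(n+2) + c(n+2) = (b(n+1) + a(n+1)) + (a(n) + c(n+1)), and b(n+1) + c(n+1) = a(n+2).\<close>

lemma num_fillings_rec:
  "num_fillings (Suc (Suc (Suc n))) =
     num_fillings (Suc (Suc n)) + num_fillings (Suc n) + num_fillings n"
  unfolding num_fillings_eq card_fillings_Suc[of "Suc (Suc n)"] card_fillings_Suc[of "Suc n"]
    card_U_tails_Suc[of "Suc n"] card_D_fillings_Suc_Suc[of n]
  by simp

lemma num_fillings_tribonacci: "num_fillings n = tribonacci (Suc n)"
  \<comment> \<open>This rule supplies the three preceding instances that the recurrence needs; the
    base case 2 matches \<open>tribonacci 3 = 3\<close>.\<close>
  by (induction n rule: tribonacci.induct)
    (simp_all add: num_fillings_0 num_fillings_1 num_fillings_2 num_fillings_rec)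

theorem proposition2:
  "num_fillings 0 = 1 \<and> num_fillings 1 = 1 \<and> num_fillings 2 = 3 \<and>
   (\<forall>n\<ge>3. num_fillings n =
      num_fillings (n - 1) + num_fillings (n - 2) + num_fillings (n - 3)) \<and>
   (\<forall>n. num_fillings n = tribonacci (n + 1))"
proof -
  have "num_fillings n = num_fillings (n - 1) + num_fillings (n - 2) + num_fillings (n - 3)"
    if n: "n \<ge> 3" for n
  proof -
    obtain m where "n = 3 + m"
      using le_Suc_ex[OF n] by blast
    then show ?thesis using num_fillings_rec[of m] by (simp add: numeral_3_eq_3)
  qed
  moreover have "num_fillings 2 = 3"
    using num_fillings_2 by (simp add: numeral_2_eq_2)
  ultimately show ?thesis
    by (simp add: num_fillings_0 num_fillings_1 num_fillings_tribonacci)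
qed

end
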